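(* Let $q$ be a prime power, $1\le k\le n$ and $m\ge 1$ an integer. Every $(k,m)$-Furstenberg set $S\subseteq\mathbb{F}_q^n$ satisfies $$|S|\ge \sqrt{m(m-1)}\,q^{(n-k)/2}.$$
   Context: $\mathbb{F}_q$ is the finite field with $q$ elements. A set $S\subseteq\mathbb{F}_q^n$ is called $(k,m)$-Furstenberg if for every $k$-dimensional linear (vector) subspace $V$ of $\mathbb{F}_q^n$ there is a translate $V+a$ ($a\in\mathbb{F}_q^n$) with $|S\cap (V+a)|\ge m$. *)

theory Defs
  imports "HOL-Analysis.Analysis"
begin

definition furstenberg :: "nat \<Rightarrow> nat \<Rightarrow> ('f::{field,finite} ^ 'n) set \<Rightarrow> bool" where
  "furstenberg k m S \<longleftrightarrow>
     (\<forall>V. vec.subspace V \<and> vec.dim V = k \<longrightarrow>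
        (\<exists>a. card (S \<inter> (\<lambda>v. v + a) ` V) \<ge> m))"

end

theory Submission imports Defs begin

text \<open>
  Count triples \<open>(x, y, V)\<close> with \<open>x \<noteq> y\<close> in \<open>S\<close>, \<open>V\<close> a \<open>k\<close>-dimensional subspace and \<open>x - y \<in> V\<close>.
  Every \<open>V\<close> contributes at least \<open>m (m - 1)\<close> pairs, coming from its rich translate. Conversely, the
  general linear group is transitive on nonzero vectors, so every difference \<open>x - y\<close> lies in
  exactly the fraction \<open>(q ^ k - 1) / (q ^ n - 1) \<le> q ^ k / q ^ n\<close> of all \<open>k\<close>-dimensional subspaces.
\<close>

text \<open>Induction on \<open>B\<close>: adjoining an independent \<open>b\<close> makes every
  vector of the new span uniquely \<open>c *s b + x\<close> with \<open>x\<close> in the old span,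
  so the size is multiplied by the order of the field.\<close>

lemma card_span_independent:
  fixes B :: "('f::{field,finite} ^ 'n) set"
  assumes "vec.independent B"
  shows "card (vec.span B) = CARD('f) ^ card B"
proof -
  have "finite B" by simp
  then show ?thesis using assms
  proof (induction B rule: finite_induct)
    case empty
    then show ?case by simp
  next
    case (insert b B)
    have ind: "vec.independent B" and nb: "b \<notin> vec.span B"
      using insert.prems insert.hyps by (simp_all add: vec.independent_insert)
    define g where "g = (\<lambda>(c::'f, x). c *s b + x)"
    have img: "g ` (UNIV \<times> vec.span B) = vec.span (insert b B)"
    proof (intro set_eqI iffI)
      fix y assume "y \<in> g ` (UNIV \<times> vec.span B)"
      then obtain c x where "x \<in> vec.span B" "y = c *s b + x" by (auto simp: g_def)
      then show "y \<in> vec.span (insert b B)"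
        by (auto simp: vec.span_insert intro!: exI[of _ c])
    next
      fix y assume "y \<in> vec.span (insert b B)"
      then obtain c where "y - c *s b \<in> vec.span B" by (auto simp: vec.span_insert)
      then have "g (c, y - c *s b) \<in> g ` (UNIV \<times> vec.span B)" by blast
      then show "y \<in> g ` (UNIV \<times> vec.span B)" by (simp add: g_def)
    qed
    have "inj_on g (UNIV \<times> vec.span B)"
    proof (rule inj_onI, clarify)
      fix c x d y
      assume x: "x \<in> vec.span B" and y: "y \<in> vec.span B" and eq: "g (c, x) = g (d, y)"
      have e: "(c - d) *s b = y - x"
        using eq by (simp add: g_def vec.scale_left_diff_distrib algebra_simps)
      \<comment> \<open>Otherwise dividing \<open>e\<close> by \<open>c - d\<close> would put
        \<open>b\<close> into \<open>vec.span B\<close>.\<close>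
      have "c = d"
      proof (rule ccontr)
        assume "c \<noteq> d"
        have "(c - d) *s b \<in> vec.span B" unfolding e using x y by (rule vec.span_diff[rotated])
        then have "inverse (c - d) *s ((c - d) *s b) \<in> vec.span B" by (rule vec.span_scale)
        moreover have "inverse (c - d) *s ((c - d) *s b) = b"
          using \<open>c \<noteq> d\<close> by (simp only: vec.scale_scale) simp
        ultimately show False using nb by simp
      qed
      with e show "c = d \<and> x = y" by simp
    qed
    then have "card (vec.span (insert b B)) = card ((UNIV::'f set) \<times> vec.span B)"
      using card_image img by metis
    then show ?case using insert.IH[OF ind] insert.hyps by (simp add: card_cartesian_product)
  qed
qed

lemma card_subspace_eq_power_dim:
  fixes V :: "('f::{field,finite} ^ 'n) set"
  assumes "vec.subspace V"
  shows "card V = CARD('f) ^ vec.dim V"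
proof -
  obtain B where B: "B \<subseteq> V" "vec.independent B" "V \<subseteq> vec.span B" "card B = vec.dim V"
    using vec.basis_exists by blast
  then have "vec.span B = V" using assms vec.span_subspace by blast
  with card_span_independent[OF B(2)] B(4) show ?thesis by simp
qed

text \<open>Extend \<open>{v}\<close> and \<open>{w}\<close> to bases, match the bases by a
  bijection sending \<open>v\<close> to \<open>w\<close>, and extend it linearly.\<close>

lemma linear_automorphism_transitive:
  fixes v w :: "'f::field ^ 'n"
  assumes "v \<noteq> 0" "w \<noteq> 0"
  obtains f where "Vector_Spaces.linear (*s) (*s) f" "inj f" "f v = w"
proof -
  have iv: "vec.independent {v}" and iw: "vec.independent {w}"
    using assms by simp_all
  define B where "B = vec.extend_basis {v}"
  define C where "C = vec.extend_basis {w}"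
  have B: "v \<in> B" "vec.independent B" "vec.span B = UNIV"
    unfolding B_def using vec.extend_basis_superset[OF iv] vec.independent_extend_basis[OF iv]
      vec.span_extend_basis[OF iv] by auto
  have C: "w \<in> C" "vec.independent C" "vec.span C = UNIV"
    unfolding C_def using vec.extend_basis_superset[OF iw] vec.independent_extend_basis[OF iw]
      vec.span_extend_basis[OF iw] by auto
  have fin: "finite B" "finite C" using B C vec.finiteI_independent by auto
  have "card B = card C"
    using B C vec.dim_span_eq_card_independent by metis
  then have "card (B - {v}) = card (C - {w})" using B(1) C(1) fin by simp
  then obtain g where g: "bij_betw g (B - {v}) (C - {w})"
    using fin by (meson finite_Diff finite_same_card_bij)
  obtain f where f: "Vector_Spaces.linear (*s) (*s) f" "\<And>x. x \<in> B \<Longrightarrow> f x = (g(v := w)) x"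
    using vec.linear_independent_extend[OF B(2)] by metis
  have "f ` (B - {v}) = g ` (B - {v})" using f(2) by (intro image_cong) auto
  then have "f ` B = C"
    using g f(2)[OF B(1)] B(1) C(1) unfolding bij_betw_def
    by (metis fun_upd_same image_insert insert_Diff)
  \<comment> \<open>The image of \<open>f\<close> is the span of \<open>C\<close>, hence everything;
    in finite dimension a surjective endomorphism is injective.\<close>
  then have "f ` UNIV = UNIV" using vec.linear_span_image[OF f(1), of B] B(3) C(3) by simp
  then have "inj f" using vec.linear_surjective_imp_injective[OF f(1)] by blast
  then show ?thesis using that f(1) f(2)[OF B(1)] by simp
qed

text \<open>An automorphism taking \<open>v\<close> to \<open>w\<close> acts injectively on
  subspaces, keeps dimensions and turns subspaces through \<open>v\<close> into subspaces through
  \<open>w\<close>. Exchanging \<open>v\<close> and \<open>w\<close> gives equality.\<close>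

lemma card_subspaces_through_le:
  fixes v w :: "'f::{field,finite} ^ 'n"
  assumes "v \<noteq> 0" "w \<noteq> 0"
  shows "card {V. vec.subspace V \<and> vec.dim V = k \<and> v \<in> V}
    \<le> card {V. vec.subspace V \<and> vec.dim V = k \<and> w \<in> V}"
proof -
  obtain f where f: "Vector_Spaces.linear (*s) (*s) f" "inj f" "f v = w"
    using linear_automorphism_transitive[OF assms] by blast
  show ?thesis
  proof (rule card_inj_on_le[where f = "\<lambda>V. f ` V"])
    show "inj_on (\<lambda>V. f ` V) {V. vec.subspace V \<and> vec.dim V = k \<and> v \<in> V}"
      using f(2) by (simp add: inj_on_def inj_image_eq_iff)
    have "vec.dim (f ` V) = vec.dim V" for V
      using vec.dim_image_eq[OF f(1)] f(2) by (meson inj_on_subset subset_UNIV)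
    then show "(\<lambda>V. f ` V) ` {V. vec.subspace V \<and> vec.dim V = k \<and> v \<in> V}
        \<subseteq> {V. vec.subspace V \<and> vec.dim V = k \<and> w \<in> V}"
      using vec.linear_subspace_image[OF f(1)] f(3) by auto
  qed simp
qed

text \<open>Both sides count the incidences between nonzero vectors and \<open>k\<close>-dimensional
  subspaces: each nonzero vector lies in equally many subspaces, and each subspace has
  \<open>CARD('f) ^ k - 1\<close> nonzero vectors.\<close>

lemma card_subspaces_through:
  fixes v :: "'f::{field,finite} ^ 'n"
  assumes "v \<noteq> 0"
  shows "card {V :: ('f ^ 'n) set. vec.subspace V \<and> vec.dim V = k \<and> v \<in> V}
      * (CARD('f) ^ CARD('n) - 1)
    = card {V :: ('f ^ 'n) set. vec.subspace V \<and> vec.dim V = k} * (CARD('f) ^ k - 1)"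
proof -
  let ?G = "{V :: ('f ^ 'n) set. vec.subspace V \<and> vec.dim V = k}"
  let ?N = "\<lambda>w. card {V :: ('f ^ 'n) set. vec.subspace V \<and> vec.dim V = k \<and> w \<in> V}"
  have N: "?N w = ?N v" if "w \<noteq> 0" for w
    using card_subspaces_through_le assms that by (intro antisym) blast+
  have "?N v * (CARD('f) ^ CARD('n) - 1) = (\<Sum>w\<in>UNIV - {0}. ?N w)"
    by (simp add: N card_Diff_singleton del: Collect_conj_eq)
  also have "\<dots> = (\<Sum>w\<in>UNIV - {0}. card {V \<in> ?G. w \<in> V})"
    by (intro sum.cong arg_cong[where f = card]) auto
  also have "\<dots> = (\<Sum>V\<in>?G. card {w \<in> UNIV - {0}. w \<in> V})"
    by (rule sum_multicount_gen) simp_all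
  also have "\<dots> = (\<Sum>V\<in>?G. CARD('f) ^ k - 1)"
  proof (rule sum.cong[OF refl])
    fix V assume "V \<in> ?G"
    then have V: "0 \<in> V" "card V = CARD('f) ^ k"
      using card_subspace_eq_power_dim[of V] by (auto simp: vec.subspace_0)
    have "{w \<in> UNIV - {0}. w \<in> V} = V - {0}" by auto
    with V show "card {w \<in> UNIV - {0}. w \<in> V} = CARD('f) ^ k - 1" by simp
  qed
  finally show ?thesis by simp
qed

lemma card_off_diagonal:
  assumes "finite A"
  shows "card {(x, y). x \<in> A \<and> y \<in> A \<and> x \<noteq> y} = card A * (card A - 1)"
proof -
  have "{(x, y). x \<in> A \<and> y \<in> A \<and> x \<noteq> y} = (SIGMA x:A. A - {x})" by auto
  with assms show ?thesis by (simp add: card_SigmaI)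
qed

text \<open>Two points of one translate of \<open>V\<close> differ by an element of
  \<open>V\<close>, so all ordered pairs of distinct points in the rich translate are
  counted.\<close>

lemma furstenberg_pairs:
  fixes S :: "('f::{field,finite} ^ 'n) set"
  assumes "furstenberg k m S" "vec.subspace V" "vec.dim V = k"
  shows "m * (m - 1) \<le> card {(x, y). x \<in> S \<and> y \<in> S \<and> x \<noteq> y \<and> x - y \<in> V}"
proof -
  obtain a where a: "m \<le> card (S \<inter> (\<lambda>v. v + a) ` V)"
    using assms unfolding furstenberg_def by blast
  let ?T = "S \<inter> (\<lambda>v. v + a) ` V"
  have "m * (m - 1) \<le> card ?T * (card ?T - 1)" using a by (intro mult_mono) auto
  also have "\<dots> = card {(x, y). x \<in> ?T \<and> y \<in> ?T \<and> x \<noteq> y}"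
    by (rule card_off_diagonal[symmetric]) simp
  also have "\<dots> \<le> card {(x, y). x \<in> S \<and> y \<in> S \<and> x \<noteq> y \<and> x - y \<in> V}"
    using vec.subspace_diff[OF assms(2)] by (intro card_mono) auto
  finally show ?thesis .
qed

lemma furstenberg_double_count:
  fixes S :: "('f::{field,finite} ^ 'n) set"
  assumes "furstenberg k m S" "k \<le> CARD('n)"
  shows "m * (m - 1) * (CARD('f) ^ CARD('n) - 1) \<le> card S * (card S - 1) * (CARD('f) ^ k - 1)"
proof -
  define G where "G = {V :: ('f ^ 'n) set. vec.subspace V \<and> vec.dim V = k}"
  define P where "P = {(x, y). x \<in> S \<and> y \<in> S \<and> x \<noteq> y}"
  let ?Q = "CARD('f) ^ CARD('n) - 1"
  \<comment> \<open>A \<open>k\<close>-dimensional subspace exists because \<open>k\<close> is at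
    most the dimension; thus \<open>card G\<close> is positive and can be cancelled at the
    end.\<close>
  have "\<exists>T. vec.subspace T \<and> T \<subseteq> vec.span (UNIV :: ('f ^ 'n) set) \<and> vec.dim T = k"
    using vec.choose_subspace_of_subspace[of k "UNIV :: ('f ^ 'n) set"] assms(2)
    by (metis vec.dim_UNIV vec_dim_card)
  then have G: "card G > 0" unfolding G_def by (auto simp: card_gt_0_iff)
  have "card G * (m * (m - 1)) \<le> (\<Sum>V\<in>G. card {p \<in> P. fst p - snd p \<in> V})"
  proof -
    have "m * (m - 1) \<le> card {p \<in> P. fst p - snd p \<in> V}" if "V \<in> G" for V
    proof -
      have "{p \<in> P. fst p - snd p \<in> V} = {(x, y). x \<in> S \<and> y \<in> S \<and> x \<noteq> y \<and> x - y \<in> V}"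
        by (auto simp: P_def)
      with furstenberg_pairs[OF assms(1)] that show ?thesis by (simp add: G_def)
    qed
    then show ?thesis using sum_bounded_below[of G "m * (m - 1)"] by simp
  qed
  \<comment> \<open>The same triples, now grouped by pairs of points instead of by
    subspaces.\<close>
  also have "\<dots> = (\<Sum>p\<in>P. card {V \<in> G. fst p - snd p \<in> V})"
    by (rule sum_multicount_gen[symmetric]) simp_all
  \<comment> \<open>The factor \<open>?Q\<close> brings each summand into the division-free form of
    \<open>card_subspaces_through\<close>.\<close>
  finally have "card G * (m * (m - 1)) * ?Q \<le> (\<Sum>p\<in>P. card {V \<in> G. fst p - snd p \<in> V} * ?Q)"
    by (simp only: sum_distrib_right[symmetric] mult_le_mono1)
  also have "\<dots> = (\<Sum>p\<in>P. card G * (CARD('f) ^ k - 1))"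
  proof (rule sum.cong[OF refl])
    fix p assume "p \<in> P"
    then have "fst p - snd p \<noteq> 0" by (auto simp: P_def)
    from card_subspaces_through[OF this, of k]
    show "card {V \<in> G. fst p - snd p \<in> V} * ?Q = card G * (CARD('f) ^ k - 1)"
      by (simp add: G_def conj_assoc)
  qed
  also have "\<dots> = card G * (card S * (card S - 1) * (CARD('f) ^ k - 1))"
    unfolding P_def by (simp add: card_off_diagonal)
  finally have "card G * (m * (m - 1) * ?Q) \<le> card G * (card S * (card S - 1) * (CARD('f) ^ k - 1))"
    by (simp add: mult.assoc)
  then show ?thesis using G by simp
qed

theorem theorem1p5:
  fixes S :: "('f::{field,finite} ^ 'n) set" and q n k m :: nat
  assumes "CARD('f) = q" and "CARD('n) = n"
    and "1 \<le> k" and "k \<le> n" and "1 \<le> m"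
    and "furstenberg k m S"
  shows "real (card S) \<ge>
    sqrt (real m * (real m - 1)) * real q powr ((real n - real k) / 2)"
proof -
  have "card {0, 1 :: 'f} \<le> CARD('f)" by (intro card_mono) auto
  then have q: "q \<ge> 2" using assms(1) by simp
  \<comment> \<open>Positivity, which rests on \<open>1 \<le> k\<close>, permits cancelling this
    factor below.\<close>
  then have qk: "q ^ k - 1 > 0" using assms(3) one_less_power[of q k] by simp
  have qn: "q ^ n = q ^ (n - k) * q ^ k" using assms(4) by (simp flip: power_add)
  \<comment> \<open>The left side is \<open>q ^ n - q ^ (n - k)\<close>, and
    \<open>q ^ (n - k)\<close> is at least 1.\<close>
  have "q ^ (n - k) * (q ^ k - 1) \<le> q ^ n - 1"
    unfolding qn using q by (simp add: diff_mult_distrib2 diff_le_mono2)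
  then have "m * (m - 1) * (q ^ (n - k) * (q ^ k - 1)) \<le> m * (m - 1) * (q ^ n - 1)"
    by (rule mult_le_mono2)
  also have "\<dots> \<le> card S * (card S - 1) * (q ^ k - 1)"
    using furstenberg_double_count[OF assms(6)] assms by simp
  finally have "m * (m - 1) * q ^ (n - k) * (q ^ k - 1) \<le> card S * (card S - 1) * (q ^ k - 1)"
    by (simp only: mult.assoc)
  then have "m * (m - 1) * q ^ (n - k) \<le> card S * (card S - 1)" using qk by simp
  also have "\<dots> \<le> (card S)\<^sup>2" by (simp add: power2_eq_square)
  finally have "real (m * (m - 1) * q ^ (n - k)) \<le> real ((card S)\<^sup>2)"
    by (simp only: of_nat_le_iff)
  \<comment> \<open>Since \<open>1 \<le> m\<close>, the truncated difference \<open>m - 1\<close>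
    agrees with the real one.\<close>
  then have le: "real m * (real m - 1) * real q ^ (n - k) \<le> (real (card S))\<^sup>2"
    using assms(5) by (simp add: of_nat_diff)
  \<comment> \<open>The halved exponent becomes a square root of an integer power, using
    \<open>k \<le> n\<close>, so that both factors merge under one root.\<close>
  have "real q powr ((real n - real k) / 2) = sqrt (real q powr (real n - real k))"
    using q by (simp add: powr_half_sqrt[symmetric] powr_powr)
  also have "real q powr (real n - real k) = real q ^ (n - k)"
    using q assms(4) by (simp add: powr_realpow[symmetric] of_nat_diff)
  finally have "sqrt (real m * (real m - 1)) * real q powr ((real n - real k) / 2)
      = sqrt (real m * (real m - 1) * real q ^ (n - k))"
    by (simp add: real_sqrt_mult)
  also have "\<dots> \<le> real (card S)" using le by (intro real_le_lsqrt) auto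
  finally show ?thesis .
qed

end
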